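(* Let $t, r$ be integers with $t \ge r \ge 2$, and let $n = 2(t-r+1)$. Then the $(t,r)$ broadcast domination number of the Cartesian product $C_n \Box C_n$ is $\gamma_{t,r}(C_n \Box C_n) = 2$. (Consequently, together with $\gamma_{t,r}(C_n)=2$, one has $\gamma_{t,r}(C_n \Box C_n) < \gamma_{t,r}(C_n)\gamma_{t,r}(C_n)$.)
   Context: Let $G=(V,E)$ be a graph and fix integers $t \ge r \ge 1$. For $D \subseteq V$ and $v \in V$, the reception at $v$ is $r(v) = \sum_{u \in D,\ \mathrm{dist}(u,v) \le t} (t - \mathrm{dist}(u,v))$, where $\mathrm{dist}$ is graph distance. $D$ is a $(t,r)$ broadcast dominating set if $r(v) \ge r$ for every $v \in V$; $\gamma_{t,r}(G)$ is the minimum cardinality of such a set. $C_n$ is the cycle on $n$ vertices (for $n=2$, two vertices joined by an edge). The Cartesian product $G \Box H$ has vertex set $V_G \times V_H$, with $(g_1,h_1)$ adjacent to $(g_2,h_2)$ iff either $g_1=g_2$ and $h_1h_2 \in E_H$, or $h_1=h_2$ and $g_1g_2 \in E_G$. *)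

theory Defs
  imports "Graph_Theory.Graph_Theory"
begin

text \<open>
  A finite simple undirected graph is a symmetric, loop-free, finite \<^typ>\<open>'a pair_pre_digraph\<close>
  (the locale \<^locale>\<open>pair_graph\<close>), each undirected edge being a pair of opposite arcs.
\<close>

text \<open>
  The cycle on \<open>{0..<n}\<close>, meant for \<open>n \<ge> 2\<close>. Arcs form a set of pairs, so for \<open>n = 2\<close> this is
  two vertices joined by a single edge.
\<close>

definition cycle_graph :: "nat \<Rightarrow> nat pair_pre_digraph" where
  "cycle_graph n =
    \<lparr> pverts = {..<n},
      parcs = {(i, j). i < n \<and> j < n \<and> (j = Suc i mod n \<or> i = Suc j mod n)} \<rparr>"

definition cart_prod ::
    "'a pair_pre_digraph \<Rightarrow> 'b pair_pre_digraph \<Rightarrow> ('a \<times> 'b) pair_pre_digraph"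
    (infixr \<open>\<box>\<close> 80) where
  "G \<box> H =
    \<lparr> pverts = pverts G \<times> pverts H,
      parcs = {((g1, h1), (g2, h2)).
        (g1 = g2 \<and> g1 \<in> pverts G \<and> (h1, h2) \<in> parcs H) \<or>
        (h1 = h2 \<and> h1 \<in> pverts H \<and> (g1, g2) \<in> parcs G)} \<rparr>"

text \<open>Unit weights make the cost of a walk its length; unreachable vertices are at distance \<open>\<infinity>\<close>.\<close>

definition graph_dist :: "'a pair_pre_digraph \<Rightarrow> 'a \<Rightarrow> 'a \<Rightarrow> ereal" where
  "graph_dist G u v = wf_digraph.\<mu> (with_proj G) (\<lambda>_. 1) u v"

definition reception :: "'a pair_pre_digraph \<Rightarrow> nat \<Rightarrow> 'a set \<Rightarrow> 'a \<Rightarrow> ereal" where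
  "reception G t D v =
    (\<Sum>u \<in> {u \<in> D. graph_dist G u v \<le> ereal (real t)}. ereal (real t) - graph_dist G u v)"

definition broadcast_dominating :: "'a pair_pre_digraph \<Rightarrow> nat \<Rightarrow> nat \<Rightarrow> 'a set \<Rightarrow> bool" where
  "broadcast_dominating G t r D \<longleftrightarrow>
    D \<subseteq> pverts G \<and> (\<forall>v \<in> pverts G. reception G t D v \<ge> ereal (real r))"

definition broadcast_domination_number :: "'a pair_pre_digraph \<Rightarrow> nat \<Rightarrow> nat \<Rightarrow> nat" where
  "broadcast_domination_number G t r =
    (LEAST k. \<exists>D. finite D \<and> broadcast_dominating G t r D \<and> card D = k)"

lemma pair_graph_cycle_graph:
  assumes "n \<ge> 2"
  shows "pair_graph (cycle_graph n)"
proof -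
  have ne: "Suc i mod n \<noteq> i" if "i < n" for i
    using that assms by (cases "Suc i = n") auto
  have fin: "finite (parcs (cycle_graph n))"
    by (rule finite_subset[of _ "{..<n} \<times> {..<n}"]) (auto simp: cycle_graph_def)
  show ?thesis
  proof
    show "finite (parcs (cycle_graph n))" by (rule fin)
    show "symmetric (with_proj (cycle_graph n))"
      by (auto simp: symmetric_def sym_def arcs_ends_def arc_to_ends_def cycle_graph_def)
  qed (use ne in \<open>force simp: cycle_graph_def\<close>)+
qed

lemma pair_graph_cart_prod:
  assumes "pair_graph G" and "pair_graph H"
  shows "pair_graph (G \<box> H)"
proof -
  interpret G: pair_graph G by fact
  interpret H: pair_graph H by fact
  have fin: "finite (parcs (G \<box> H))"
    by (rule finite_subset[of _ "(pverts G \<times> pverts H) \<times> (pverts G \<times> pverts H)"])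
       (auto simp: cart_prod_def dest: G.wellformed H.wellformed)
  show ?thesis
  proof
    show "finite (parcs (G \<box> H))" by (rule fin)
    show "symmetric (with_proj (G \<box> H))"
      using G.sym_arcs H.sym_arcs
      by (auto simp: symmetric_def sym_def arcs_ends_def arc_to_ends_def cart_prod_def)
  qed (auto simp: cart_prod_def dest: G.wellformed H.wellformed G.no_loops H.no_loops)
qed

end

theory Submission
  imports Defs
begin

text \<open>
  On an even cycle \<open>C\<^bsub>2m\<^esub>\<close> the distances from any vertex to two antipodal vertices sum to \<open>m\<close>.
  Distances in a Cartesian product add up, so on the torus \<open>C\<^bsub>2m\<^esub> \<box> C\<^bsub>2m\<^esub>\<close> they sum to \<open>2m\<close>. If they
  always sum to \<open>k\<close>, an antipodal pair of broadcasting vertices gives reception at least \<open>2t - k\<close>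
  everywhere, whereas a single one is received with only \<open>max 0 (t - k)\<close> at its antipode. Hence the
  number is \<open>2\<close> as soon as \<open>t - k < r \<le> 2t - k\<close>, and for \<open>m = t - r + 1\<close> and \<open>r \<ge> 2\<close> both \<open>k = m\<close>
  and \<open>k = 2m\<close> satisfy this.
\<close>

section \<open>Distances\<close>

context pair_fin_digraph
begin

lemma graph_dist_self:
  assumes "u \<in> pverts G"
  shows "graph_dist G u u = 0"
proof -
  obtain p where "apath u p u" and dist: "graph_dist G u u = awalk_cost (\<lambda>_. 1) p"
    unfolding graph_dist_def using min_cost_awalk[OF reachable_refl, of u "\<lambda>_. 1"] assms by auto
  then have "p = []"
    using apath_nonempty_ends by blast
  then show ?thesis
    using dist by simp
qed

lemma graph_dist_arc_le:
  assumes "(v, w) \<in> parcs G"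
  shows "graph_dist G u w \<le> graph_dist G u v + 1"
  using pos_cost_mu_triangle[of "\<lambda>_. 1" "(v, w)" v w u] assms
  by (simp add: graph_dist_def arc_to_ends_def one_ereal_def)

lemma le_add_graph_dist_if_arc_le:
  fixes f :: "'a \<Rightarrow> ereal"
  assumes arc_le: "\<And>x y. (x, y) \<in> parcs G \<Longrightarrow> f y \<le> f x + 1"
  shows "f v \<le> f u + graph_dist G u v"
proof (cases "graph_dist G u v = \<infinity>")
  case True
  then show ?thesis by simp
next
  case False
  have walk_le: "f v \<le> f u + awalk_cost (\<lambda>_. 1) p" if "awalk u p v" for p
    using that
  proof (induction p arbitrary: u)
    case Nil
    then show ?case by (simp add: awalk_Nil_iff)
  next
    case (Cons e p)
    then have "e \<in> parcs G" "u = fst e" "awalk (snd e) p v"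
      by (auto simp: awalk_Cons_iff)
    then have "f v \<le> f (snd e) + awalk_cost (\<lambda>_. 1) p"
      by (intro Cons.IH)
    also have "\<dots> \<le> (f u + 1) + awalk_cost (\<lambda>_. 1) p"
      using arc_le[of "fst e" "snd e"] \<open>e \<in> parcs G\<close> \<open>u = fst e\<close> by (intro add_right_mono) simp
    finally show ?case
      by (simp add: add.assoc one_ereal_def)
  qed
  have "reachable (with_proj G) u v"
    using False by (simp add: graph_dist_def flip: \<mu>_reach_conv[of "\<lambda>_. 1"])
  then obtain p where "apath u p v" "graph_dist G u v = awalk_cost (\<lambda>_. 1) p"
    unfolding graph_dist_def using min_cost_awalk[of u v "\<lambda>_. 1"] by auto
  then show ?thesis
    using walk_le awalkI_apath by simp
qed

end

lemma pverts_cart_prod [simp]: "pverts (G \<box> H) = pverts G \<times> pverts H"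
  by (simp add: cart_prod_def)

lemma parcs_cart_prod_iff:
  "((a, b), (c, d)) \<in> parcs (G \<box> H) \<longleftrightarrow>
    a = c \<and> a \<in> pverts G \<and> (b, d) \<in> parcs H \<or> b = d \<and> b \<in> pverts H \<and> (a, c) \<in> parcs G"
  by (simp add: cart_prod_def)

lemma graph_dist_cart_prod_le:
  assumes "pair_graph G" "pair_graph H"
    and "a \<in> pverts G" "b \<in> pverts H" "c \<in> pverts G"
  shows "graph_dist (G \<box> H) (a, b) (c, d) \<le> graph_dist G a c + graph_dist H b d"
proof -
  interpret G: pair_graph G by fact
  interpret H: pair_graph H by fact
  interpret GH: pair_graph "G \<box> H" using assms(1,2) by (rule pair_graph_cart_prod)
  let ?\<delta> = "graph_dist (G \<box> H) (a, b)"
  have "?\<delta> (c, d) \<le> ?\<delta> (c, b) + graph_dist H b d"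
    using \<open>c \<in> pverts G\<close>
    by (intro H.le_add_graph_dist_if_arc_le[of "\<lambda>y. ?\<delta> (c, y)"] GH.graph_dist_arc_le)
      (simp add: parcs_cart_prod_iff)
  also have "?\<delta> (c, b) \<le> ?\<delta> (a, b) + graph_dist G a c"
    using \<open>b \<in> pverts H\<close>
    by (intro G.le_add_graph_dist_if_arc_le[of "\<lambda>x. ?\<delta> (x, b)"] GH.graph_dist_arc_le)
      (simp add: parcs_cart_prod_iff)
  also have "?\<delta> (a, b) = 0"
    using assms by (intro GH.graph_dist_self) simp
  finally show ?thesis
    by (simp add: add_right_mono)
qed

lemma graph_dist_cart_prod_ge:
  assumes "pair_graph G" "pair_graph H"
    and "a \<in> pverts G" "b \<in> pverts H"
  shows "graph_dist G a c + graph_dist H b d \<le> graph_dist (G \<box> H) (a, b) (c, d)"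
proof -
  interpret G: pair_graph G by fact
  interpret H: pair_graph H by fact
  interpret GH: pair_graph "G \<box> H" using assms(1,2) by (rule pair_graph_cart_prod)
  let ?f = "\<lambda>(x, y). graph_dist G a x + graph_dist H b y"
  have "?f q \<le> ?f p + 1" if "(p, q) \<in> parcs (G \<box> H)" for p q
  proof -
    obtain x y x' y' where pq: "p = (x, y)" "q = (x', y')" by fastforce
    with that consider
        (vertical) "x = x'" "(y, y') \<in> parcs H"
      | (horizontal) "y = y'" "(x, x') \<in> parcs G"
      by (auto simp: parcs_cart_prod_iff)
    then show ?thesis
    proof cases
      case vertical
      then show ?thesis
        using add_left_mono[OF H.graph_dist_arc_le[of y y' b], of "graph_dist G a x"]
        by (simp add: pq ac_simps)
    next
      case horizontal
      then show ?thesis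
        using add_right_mono[OF G.graph_dist_arc_le[of x x' a], of "graph_dist H b y"]
        by (simp add: pq ac_simps)
    qed
  qed
  then have "?f (c, d) \<le> ?f (a, b) + graph_dist (G \<box> H) (a, b) (c, d)"
    by (rule GH.le_add_graph_dist_if_arc_le)
  then show ?thesis
    using assms by (simp add: G.graph_dist_self H.graph_dist_self)
qed

lemma graph_dist_cart_prod:
  assumes "pair_graph G" "pair_graph H"
    and "a \<in> pverts G" "b \<in> pverts H" "c \<in> pverts G"
  shows "graph_dist (G \<box> H) (a, b) (c, d) = graph_dist G a c + graph_dist H b d"
  using assms by (intro antisym graph_dist_cart_prod_le graph_dist_cart_prod_ge)

lemma pverts_cycle_graph [simp]: "pverts (cycle_graph n) = {..<n}"
  by (simp add: cycle_graph_def)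

lemma parcs_cycle_graph_iff:
  "(i, j) \<in> parcs (cycle_graph n) \<longleftrightarrow>
    i < n \<and> j < n \<and> (j = Suc i mod n \<or> i = Suc j mod n)"
  by (simp add: cycle_graph_def)

definition circular_dist :: "nat \<Rightarrow> nat \<Rightarrow> nat \<Rightarrow> real" where
  "circular_dist n i j = min \<bar>real i - real j\<bar> (real n - \<bar>real i - real j\<bar>)"

lemma circular_dist_arc_le:
  assumes "i < n" "(x, y) \<in> parcs (cycle_graph n)"
  shows "circular_dist n i y \<le> circular_dist n i x + 1"
proof -
  have "x < n" "y < n" and "y = Suc x mod n \<or> x = Suc y mod n"
    using assms(2) by (auto simp: parcs_cycle_graph_iff)
  then have "y = Suc x \<or> y = 0 \<and> n = Suc x \<or> x = Suc y \<or> x = 0 \<and> n = Suc y"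
    by (metis Suc_lessI mod_less mod_self)
  then show ?thesis
    using assms(1) \<open>x < n\<close> \<open>y < n\<close> unfolding circular_dist_def by (elim disjE) auto
qed

lemma graph_dist_cycle_graph_forward_le:
  assumes "n \<ge> 2" "i < n"
  shows "graph_dist (cycle_graph n) i ((i + k) mod n) \<le> ereal (real k)"
proof -
  interpret pair_graph "cycle_graph n" using assms(1) by (rule pair_graph_cycle_graph)
  show ?thesis
  proof (induction k)
    case 0
    then show ?case using assms(2) by (simp add: graph_dist_self)
  next
    case (Suc k)
    have "((i + k) mod n, (i + Suc k) mod n) \<in> parcs (cycle_graph n)"
      using assms(2) by (simp add: parcs_cycle_graph_iff mod_Suc_eq)
    then have "graph_dist (cycle_graph n) i ((i + Suc k) mod n)
        \<le> graph_dist (cycle_graph n) i ((i + k) mod n) + 1"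
      by (rule graph_dist_arc_le)
    also have "\<dots> \<le> ereal (real k) + 1"
      using Suc.IH by (rule add_right_mono)
    finally show ?case by (simp add: one_ereal_def add.commute)
  qed
qed

lemma graph_dist_cycle_graph_backward_le:
  assumes "n \<ge> 2" "j < n"
  shows "graph_dist (cycle_graph n) ((j + k) mod n) j \<le> ereal (real k)"
proof -
  interpret pair_graph "cycle_graph n" using assms(1) by (rule pair_graph_cycle_graph)
  show ?thesis
    using assms(2)
  proof (induction k arbitrary: j)
    case 0
    then show ?case by (simp add: graph_dist_self)
  next
    case (Suc k)
    let ?\<delta> = "graph_dist (cycle_graph n) ((j + Suc k) mod n)"
    have "(Suc j mod n, j) \<in> parcs (cycle_graph n)"
      using Suc.prems by (simp add: parcs_cycle_graph_iff)
    then have "?\<delta> j \<le> ?\<delta> (Suc j mod n) + 1"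
      by (rule graph_dist_arc_le)
    also have "?\<delta> (Suc j mod n) \<le> ereal (real k)"
      using Suc.IH[of "Suc j mod n"] Suc.prems by (simp add: mod_add_left_eq)
    finally show ?case by (simp add: one_ereal_def add.commute add_right_mono)
  qed
qed

lemma graph_dist_cycle_graph:
  assumes "n \<ge> 2" "i < n" "j < n"
  shows "graph_dist (cycle_graph n) i j = ereal (circular_dist n i j)"
proof (rule antisym)
  interpret pair_graph "cycle_graph n" using assms(1) by (rule pair_graph_cycle_graph)
  note forward = graph_dist_cycle_graph_forward_le[OF \<open>n \<ge> 2\<close> \<open>i < n\<close>]
    and backward = graph_dist_cycle_graph_backward_le[OF \<open>n \<ge> 2\<close> \<open>j < n\<close>]
  show "graph_dist (cycle_graph n) i j \<le> ereal (circular_dist n i j)"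
  proof (cases "i \<le> j")
    case True
    then show ?thesis
      using forward[of "j - i"] backward[of "n - (j - i)"] assms
      by (simp add: circular_dist_def min_def of_nat_diff algebra_simps)
  next
    case False
    then show ?thesis
      using backward[of "i - j"] forward[of "n - (i - j)"] assms
      by (simp add: circular_dist_def min_def of_nat_diff algebra_simps)
  qed
  have "ereal (circular_dist n i j)
      \<le> ereal (circular_dist n i i) + graph_dist (cycle_graph n) i j"
    using circular_dist_arc_le[OF \<open>i < n\<close>]
    by (intro le_add_graph_dist_if_arc_le) (simp add: one_ereal_def)
  then show "ereal (circular_dist n i j) \<le> graph_dist (cycle_graph n) i j"
    by (simp add: circular_dist_def flip: zero_ereal_def)
qed

section \<open>Antipodal graphs\<close>

definition antipodal :: "'a pair_pre_digraph \<Rightarrow> nat \<Rightarrow> bool" where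
  "antipodal G k \<longleftrightarrow>
    (\<forall>u \<in> pverts G. \<exists>w \<in> pverts G. \<forall>v \<in> pverts G.
      graph_dist G u v + graph_dist G w v = ereal (real k))"

lemma antipodalE:
  assumes "antipodal G k" "u \<in> pverts G"
  obtains w where "w \<in> pverts G"
    and "\<And>v. v \<in> pverts G \<Longrightarrow> graph_dist G u v + graph_dist G w v = ereal (real k)"
  using assms unfolding antipodal_def by blast

lemma (in pair_fin_digraph) antipodal_obtains_graph_dist:
  assumes "antipodal G k" "u \<in> pverts G"
  obtains w where "w \<in> pverts G" "graph_dist G u w = ereal (real k)"
proof -
  obtain w where "w \<in> pverts G" "graph_dist G u w + graph_dist G w w = ereal (real k)"
    using antipodalE[OF assms] by metis
  then show ?thesis
    using that by (simp add: graph_dist_self)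
qed

lemma antipodal_cart_prod:
  assumes "pair_graph G" "pair_graph H" "antipodal G k" "antipodal H l"
  shows "antipodal (G \<box> H) (k + l)"
  unfolding antipodal_def
proof
  fix u assume "u \<in> pverts (G \<box> H)"
  then obtain a b where u: "u = (a, b)" "a \<in> pverts G" "b \<in> pverts H" by auto
  obtain a' where a': "a' \<in> pverts G"
    "\<And>x. x \<in> pverts G \<Longrightarrow> graph_dist G a x + graph_dist G a' x = ereal (real k)"
    using antipodalE[OF assms(3) u(2)] by blast
  obtain b' where b': "b' \<in> pverts H"
    "\<And>y. y \<in> pverts H \<Longrightarrow> graph_dist H b y + graph_dist H b' y = ereal (real l)"
    using antipodalE[OF assms(4) u(3)] by blast
  have "graph_dist (G \<box> H) u (x, y) + graph_dist (G \<box> H) (a', b') (x, y) = ereal (real (k + l))"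
    if "x \<in> pverts G" "y \<in> pverts H" for x y
  proof -
    have "graph_dist (G \<box> H) u (x, y) + graph_dist (G \<box> H) (a', b') (x, y)
        = (graph_dist G a x + graph_dist G a' x) + (graph_dist H b y + graph_dist H b' y)"
      using u a'(1) b'(1) that assms(1,2) by (simp add: graph_dist_cart_prod ac_simps)
    then show ?thesis
      using a'(2) b'(2) that by simp
  qed
  then show "\<exists>w \<in> pverts (G \<box> H). \<forall>v \<in> pverts (G \<box> H).
      graph_dist (G \<box> H) u v + graph_dist (G \<box> H) w v = ereal (real (k + l))"
    using a'(1) b'(1) by (intro bexI[of _ "(a', b')"]) auto
qed

lemma antipodal_cycle_graph:
  assumes "m > 0"
  shows "antipodal (cycle_graph (2 * m)) m"
  unfolding antipodal_def
proof
  fix i assume "i \<in> pverts (cycle_graph (2 * m))"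
  then have "i < 2 * m" by simp
  define i' where "i' = (if i < m then i + m else i - m)"
  have "i' < 2 * m"
    using \<open>i < 2 * m\<close> by (auto simp: i'_def)
  have "circular_dist (2 * m) i j + circular_dist (2 * m) i' j = real m" if "j < 2 * m" for j
    using \<open>i < 2 * m\<close> that by (auto simp: circular_dist_def i'_def min_def abs_if)
  then show "\<exists>w \<in> pverts (cycle_graph (2 * m)). \<forall>j \<in> pverts (cycle_graph (2 * m)).
      graph_dist (cycle_graph (2 * m)) i j + graph_dist (cycle_graph (2 * m)) w j = ereal (real m)"
    using \<open>i < 2 * m\<close> \<open>i' < 2 * m\<close> assms
    by (intro bexI[of _ i']) (simp_all add: graph_dist_cycle_graph)
qed

section \<open>Broadcast domination\<close>

lemma reception_eq_sum_max:
  assumes "finite D"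
  shows "reception G t D v = (\<Sum>u\<in>D. max 0 (ereal (real t) - graph_dist G u v))"
proof -
  have "(if graph_dist G u v \<le> ereal (real t) then ereal (real t) - graph_dist G u v else 0)
      = max 0 (ereal (real t) - graph_dist G u v)" for u
    by (cases "graph_dist G u v") auto
  then show ?thesis
    using assms by (simp add: reception_def sum.inter_filter)
qed

lemma broadcast_domination_number_eqI:
  assumes "finite D" "broadcast_dominating G t r D"
    and "\<And>D'. finite D' \<Longrightarrow> broadcast_dominating G t r D' \<Longrightarrow> card D \<le> card D'"
  shows "broadcast_domination_number G t r = card D"
  unfolding broadcast_domination_number_def using assms by (intro Least_equality) blast+

lemma not_broadcast_dominating_empty:
  assumes "pverts G \<noteq> {}" "r > 0"
  shows "\<not> broadcast_dominating G t r {}"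
  using assms by (auto simp: broadcast_dominating_def reception_def)

lemma not_broadcast_dominating_singleton:
  assumes "v \<in> pverts G" "r > 0" "ereal (real t) < graph_dist G u v + ereal (real r)"
  shows "\<not> broadcast_dominating G t r {u}"
proof -
  have "reception G t {u} v = max 0 (ereal (real t) - graph_dist G u v)"
    by (simp add: reception_eq_sum_max)
  also have "\<dots> < ereal (real r)"
    using assms(2,3) by (cases "graph_dist G u v") auto
  finally show ?thesis
    using assms(1) by (auto simp: broadcast_dominating_def not_le)
qed

lemma broadcast_dominating_pairI:
  assumes "u \<in> pverts G" "w \<in> pverts G" "u \<noteq> w" "k + r \<le> 2 * t"
    and sum_dist: "\<And>v. v \<in> pverts G \<Longrightarrow>
      graph_dist G u v + graph_dist G w v \<le> ereal (real k)"
  shows "broadcast_dominating G t r {u, w}"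
proof -
  have "ereal (real r) \<le> reception G t {u, w} v" if "v \<in> pverts G" for v
  proof -
    have "ereal (real r)
        \<le> (ereal (real t) - graph_dist G u v) + (ereal (real t) - graph_dist G w v)"
      using sum_dist[OF that] assms(4)
      by (cases "graph_dist G u v"; cases "graph_dist G w v") auto
    also have "\<dots> \<le> reception G t {u, w} v"
      using assms(3) by (simp add: reception_eq_sum_max add_mono)
    finally show ?thesis .
  qed
  then show ?thesis
    using assms(1,2) by (simp add: broadcast_dominating_def)
qed

lemma (in pair_fin_digraph) two_le_card_broadcast_dominating_if_antipodal:
  assumes "antipodal G k" "pverts G \<noteq> {}" "r > 0" "t < k + r"
    and "finite D" "broadcast_dominating G t r D"
  shows "2 \<le> card D"
proof -
  have "D \<noteq> {}"
    using assms(6) not_broadcast_dominating_empty[OF assms(2,3)] by auto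
  moreover have "D \<noteq> {x}" for x
  proof
    assume "D = {x}"
    then have "x \<in> pverts G"
      using assms(6) by (simp add: broadcast_dominating_def)
    then obtain y where "y \<in> pverts G" "graph_dist G x y = ereal (real k)"
      using antipodal_obtains_graph_dist[OF assms(1)] by blast
    then show False
      using not_broadcast_dominating_singleton[of y G r t x] assms(6) \<open>D = {x}\<close> assms(3,4) by simp
  qed
  ultimately have "card D \<noteq> 0" "card D \<noteq> 1"
    using assms(5) by (auto simp: card_1_singleton_iff)
  then show ?thesis by simp
qed

lemma (in pair_fin_digraph) broadcast_domination_number_eq_2_if_antipodal:
  assumes "antipodal G k" "pverts G \<noteq> {}" "k > 0" "r > 0" "t < k + r" "k + r \<le> 2 * t"
  shows "broadcast_domination_number G t r = 2"
proof -
  obtain u where u: "u \<in> pverts G" using assms(2) by blast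
  then obtain w where w: "w \<in> pverts G"
    "\<And>v. v \<in> pverts G \<Longrightarrow> graph_dist G u v + graph_dist G w v = ereal (real k)"
    using antipodalE[OF assms(1)] by blast
  have "u \<noteq> w"
    using w(2)[OF u] u \<open>k > 0\<close> by (auto simp: graph_dist_self zero_ereal_def)
  have "broadcast_domination_number G t r = card {u, w}"
  proof (rule broadcast_domination_number_eqI)
    show "broadcast_dominating G t r {u, w}"
      using u w \<open>u \<noteq> w\<close> assms(6) by (intro broadcast_dominating_pairI) auto
  next
    fix D assume "finite D" "broadcast_dominating G t r D"
    then have "2 \<le> card D"
      using two_le_card_broadcast_dominating_if_antipodal assms(1,2,4,5) by blast
    then show "card {u, w} \<le> card D"
      using \<open>u \<noteq> w\<close> by simp
  qed simp
  then show ?thesis using \<open>u \<noteq> w\<close> by simp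
qed

theorem theorem2:
  fixes t r n :: nat
  assumes "t \<ge> r" and "r \<ge> 2"
    and "n = 2 * (t - r + 1)"
  shows "broadcast_domination_number (cycle_graph n \<box> cycle_graph n) t r = 2
    \<and> broadcast_domination_number (cycle_graph n) t r = 2
    \<and> broadcast_domination_number (cycle_graph n \<box> cycle_graph n) t r
        < broadcast_domination_number (cycle_graph n) t r
          * broadcast_domination_number (cycle_graph n) t r"
proof -
  define m where "m = t - r + 1"
  have "n = 2 * m" "m > 0" "m + r = t + 1"
    using assms by (auto simp: m_def)
  interpret C: pair_graph "cycle_graph n"
    using \<open>n = 2 * m\<close> \<open>m > 0\<close> by (intro pair_graph_cycle_graph) simp
  interpret T: pair_graph "cycle_graph n \<box> cycle_graph n"
    by (intro pair_graph_cart_prod C.pair_graph_axioms)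
  have antipodal_cycle: "antipodal (cycle_graph n) m"
    using antipodal_cycle_graph \<open>n = 2 * m\<close> \<open>m > 0\<close> by simp
  have antipodal_torus: "antipodal (cycle_graph n \<box> cycle_graph n) (m + m)"
    by (intro antipodal_cart_prod C.pair_graph_axioms antipodal_cycle)
  have "broadcast_domination_number (cycle_graph n) t r = 2"
    using assms(2) \<open>n = 2 * m\<close> \<open>m > 0\<close> \<open>m + r = t + 1\<close>
    by (intro C.broadcast_domination_number_eq_2_if_antipodal[OF antipodal_cycle])
      (auto simp: lessThan_empty_iff)
  moreover have "broadcast_domination_number (cycle_graph n \<box> cycle_graph n) t r = 2"
    using assms(2) \<open>n = 2 * m\<close> \<open>m > 0\<close> \<open>m + r = t + 1\<close>
    by (intro T.broadcast_domination_number_eq_2_if_antipodal[OF antipodal_torus])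
      (auto simp: lessThan_empty_iff)
  ultimately show ?thesis by simp
qed

end
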